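(* Let $C_{25}$ be the cyclic group of order $25$, let $\rho_6:\mathbb{Z}\to\operatorname{Aut}(C_{25})$ be the homomorphism sending $1$ to the automorphism $\alpha_6$ of $C_{25}$ which maps each element to its $6$-th power, and let $G_6:=C_{25}\rtimes_{\rho_6}\mathbb{Z}$. Then $G_6$ is not first order rigid.
   Context: Two groups are elementarily equivalent if every first order sentence in the language of groups that holds in one also holds in the other. A finitely generated group $\Gamma$ is first order rigid if every finitely generated group that is elementarily equivalent to $\Gamma$ is isomorphic to $\Gamma$. *)

theory Defs
  imports "HOL-Algebra.Algebra" "HOL-Library.Countable_Set"
begin

section \<open>The first order language of groups\<close>

datatype group_term =
    TVar nat
  | TOne
  | TMult group_term group_term
  | TInv group_term

instance group_term :: countable
  by countable_datatype

datatype group_formula =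
    FEq group_term group_term
  | FNeg group_formula
  | FConj group_formula group_formula
  | FForall nat group_formula

text \<open>Disjunction, implication and existential quantification are definable from these
  connectives, so this is full first order logic with equality.\<close>

fun term_vars :: "group_term \<Rightarrow> nat set" where
  "term_vars (TVar n) = {n}"
| "term_vars TOne = {}"
| "term_vars (TMult s t) = term_vars s \<union> term_vars t"
| "term_vars (TInv t) = term_vars t"

fun free_vars :: "group_formula \<Rightarrow> nat set" where
  "free_vars (FEq s t) = term_vars s \<union> term_vars t"
| "free_vars (FNeg \<phi>) = free_vars \<phi>"
| "free_vars (FConj \<phi> \<psi>) = free_vars \<phi> \<union> free_vars \<psi>"
| "free_vars (FForall n \<phi>) = free_vars \<phi> - {n}"

definition is_sentence :: "group_formula \<Rightarrow> bool" where
  "is_sentence \<phi> \<longleftrightarrow> free_vars \<phi> = {}"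

fun eval_term :: "('a, 'm) monoid_scheme \<Rightarrow> (nat \<Rightarrow> 'a) \<Rightarrow> group_term \<Rightarrow> 'a" where
  "eval_term G e (TVar n) = e n"
| "eval_term G e TOne = \<one>\<^bsub>G\<^esub>"
| "eval_term G e (TMult s t) = eval_term G e s \<otimes>\<^bsub>G\<^esub> eval_term G e t"
| "eval_term G e (TInv t) = inv\<^bsub>G\<^esub> (eval_term G e t)"

fun satisfies :: "('a, 'm) monoid_scheme \<Rightarrow> (nat \<Rightarrow> 'a) \<Rightarrow> group_formula \<Rightarrow> bool" where
  "satisfies G e (FEq s t) \<longleftrightarrow> eval_term G e s = eval_term G e t"
| "satisfies G e (FNeg \<phi>) \<longleftrightarrow> \<not> satisfies G e \<phi>"
| "satisfies G e (FConj \<phi> \<psi>) \<longleftrightarrow> satisfies G e \<phi> \<and> satisfies G e \<psi>"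
| "satisfies G e (FForall n \<phi>) \<longleftrightarrow> (\<forall>x \<in> carrier G. satisfies G (e(n := x)) \<phi>)"

text \<open>For a sentence the choice of the assignment is irrelevant; assignments
  must take values in the carrier.\<close>

definition holds_in :: "('a, 'm) monoid_scheme \<Rightarrow> group_formula \<Rightarrow> bool" where
  "holds_in G \<phi> \<longleftrightarrow> (\<forall>e. range e \<subseteq> carrier G \<longrightarrow> satisfies G e \<phi>)"

definition elementarily_equivalent ::
  "('a, 'm) monoid_scheme \<Rightarrow> ('b, 'n) monoid_scheme \<Rightarrow> bool" where
  "elementarily_equivalent G H \<longleftrightarrow>
     (\<forall>\<phi>. is_sentence \<phi> \<longrightarrow> (holds_in G \<phi> \<longleftrightarrow> holds_in H \<phi>))"


section \<open>First order rigidity\<close>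

definition finitely_generated_group :: "('a, 'm) monoid_scheme \<Rightarrow> bool" where
  "finitely_generated_group G \<longleftrightarrow>
     group G \<and> (\<exists>S. finite S \<and> S \<subseteq> carrier G \<and> generate G S = carrier G)"

text \<open>HOL cannot quantify over groups of all types inside a definition. Finitely generated
  groups are countable, so it is enough to let the competing group \<open>H\<close> range over groups whose
  carrier is a (finite or infinite) set of natural numbers; the lemma
  \<open>first_order_rigid_any_type\<close> below shows that this loses nothing.\<close>

definition first_order_rigid :: "('a, 'm) monoid_scheme \<Rightarrow> bool" where
  "first_order_rigid G \<longleftrightarrow>
     (\<forall>H :: nat monoid. finitely_generated_group H \<and> elementarily_equivalent H G \<longrightarrow> H \<cong> G)"

lemma eval_term_closed:
  assumes "group G" "range e \<subseteq> carrier G"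
  shows "eval_term G e t \<in> carrier G"
proof -
  interpret group G by fact
  show ?thesis using assms(2) by (induction t) auto
qed

lemma eval_term_iso:
  assumes G: "group G" and H: "group H" and h: "h \<in> hom G H" and e: "range e \<subseteq> carrier G"
  shows "eval_term H (h \<circ> e) t = h (eval_term G e t)"
proof -
  interpret group_hom G H h
    using G H h by (simp add: group_hom_def group_hom_axioms_def)
  show ?thesis
    by (induction t) (simp_all add: eval_term_closed[OF G e])
qed

lemma satisfies_iso:
  assumes G: "group G" and H: "group H" and h: "h \<in> iso G H" and e: "range e \<subseteq> carrier G"
  shows "satisfies H (h \<circ> e) \<phi> \<longleftrightarrow> satisfies G e \<phi>"
  using e
proof (induction \<phi> arbitrary: e)
  case (FEq s t)
  have "inj_on h (carrier G)" "h \<in> hom G H"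
    using h by (auto simp: iso_iff)
  then show ?case
    by (simp only: satisfies.simps eval_term_iso[OF G H _ FEq] inj_on_eq_iff
        eval_term_closed[OF G FEq])
next
  case (FForall n \<phi>)
  have img: "carrier H = h ` carrier G"
    using h by (auto simp: iso_iff)
  have "satisfies H ((h \<circ> e)(n := h x)) \<phi> \<longleftrightarrow> satisfies G (e(n := x)) \<phi>"
    if "x \<in> carrier G" for x
  proof -
    have "range (e(n := x)) \<subseteq> carrier G"
      using FForall.prems that by auto
    from FForall.IH[OF this] show ?thesis
      by (simp only: fun_upd_comp)
  qed
  then show ?case
    by (simp only: satisfies.simps img ball_simps cong: ball_cong)
qed simp_all

lemma iso_imp_elementarily_equivalent:
  assumes G: "group G" and H: "group H" and "G \<cong> H"
  shows "elementarily_equivalent G H"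
proof -
  obtain h where h: "h \<in> iso G H"
    using \<open>G \<cong> H\<close> by (auto simp: is_iso_def)
  then have img: "carrier H = h ` carrier G"
    by (auto simp: iso_iff)
  have "holds_in G \<phi> \<longleftrightarrow> holds_in H \<phi>" for \<phi>
  proof
    assume L: "holds_in G \<phi>"
    show "holds_in H \<phi>"
      unfolding holds_in_def
    proof (intro allI impI)
      fix e' :: "nat \<Rightarrow> 'c" assume e': "range e' \<subseteq> carrier H"
      define e where "e = inv_into (carrier G) h \<circ> e'"
      have in_img: "e' n \<in> h ` carrier G" for n
        using e' img by blast
      have e: "range e \<subseteq> carrier G"
        unfolding e_def comp_def using inv_into_into[OF in_img] by blast
      have "h \<circ> e = e'"
        by (rule ext) (simp add: e_def f_inv_into_f[OF in_img])
      then show "satisfies H e' \<phi>"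
        using L e satisfies_iso[OF G H h e, of \<phi>] by (simp only: holds_in_def)
    qed
  next
    assume R: "holds_in H \<phi>"
    show "holds_in G \<phi>"
      unfolding holds_in_def
    proof (intro allI impI)
      fix e :: "nat \<Rightarrow> 'a" assume e: "range e \<subseteq> carrier G"
      then have "range (h \<circ> e) \<subseteq> carrier H"
        by (auto simp: img)
      then show "satisfies G e \<phi>"
        using R satisfies_iso[OF G H h e, of \<phi>] by (simp only: holds_in_def)
    qed
  qed
  then show ?thesis
    by (simp add: elementarily_equivalent_def)
qed

lemma finitely_generated_imp_countable:
  assumes "finitely_generated_group G"
  shows "countable (carrier G)"
proof -
  obtain S where G: "group G" and S: "finite S" "generate G S = carrier G"
    using assms by (auto simp: finitely_generated_group_def)
  obtain e :: "nat \<Rightarrow> 'a" where e: "S \<subseteq> range e"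
    using subset_range_from_nat_into[OF countable_finite[OF S(1)]] by blast
  have "\<exists>t. x = eval_term G e t" if "x \<in> generate G S" for x
    using that
  proof induction
    case one
    show ?case by (rule exI[of _ TOne]) simp
  next
    case (incl h)
    then obtain n where "h = e n" using e by blast
    then show ?case by (intro exI[of _ "TVar n"]) simp
  next
    case (inv h)
    then obtain n where "h = e n" using e by blast
    then show ?case by (intro exI[of _ "TInv (TVar n)"]) simp
  next
    case (eng x y)
    then obtain s t where "x = eval_term G e s" "y = eval_term G e t" by blast
    then show ?case by (intro exI[of _ "TMult s t"]) simp
  qed
  then have "carrier G \<subseteq> range (eval_term G e)"
    using S(2) by blast
  then show ?thesis
    by (rule countable_subset) simp
qed

lemma finitely_generated_group_iso:
  assumes fg: "finitely_generated_group G" and H: "group H" and "G \<cong> H"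
  shows "finitely_generated_group H"
proof -
  obtain S where G: "group G" and S: "finite S" "S \<subseteq> carrier G" "generate G S = carrier G"
    using fg by (auto simp: finitely_generated_group_def)
  obtain h where h: "h \<in> iso G H"
    using \<open>G \<cong> H\<close> by (auto simp: is_iso_def)
  then have img: "carrier H = h ` carrier G" and hom: "h \<in> hom G H"
    by (auto simp: iso_iff)
  interpret group_hom G H h
    using G H hom by (simp add: group_hom_def group_hom_axioms_def)
  have "generate H (h ` S) = carrier H"
    using generate_img[OF S(2)] S(3) img by simp
  then show ?thesis
    unfolding finitely_generated_group_def using H S(1,2) img
    by (intro conjI exI[of _ "h ` S"]) auto
qed

lemma countable_group_iso_nat:
  assumes G: "group G" and "countable (carrier G)"
  obtains H :: "nat monoid" where "group H" "G \<cong> H"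
proof -
  interpret group G by fact
  obtain f :: "'a \<Rightarrow> nat" where f: "inj_on f (carrier G)"
    using assms(2) by (auto simp: countable_def)
  define g where "g = inv_into (carrier G) f"
  have gf [simp]: "g (f x) = x" if "x \<in> carrier G" for x
    using f that by (simp add: g_def)
  define H where
    "H = \<lparr>carrier = f ` carrier G, monoid.mult = (\<lambda>a b. f (g a \<otimes>\<^bsub>G\<^esub> g b)), one = f \<one>\<^bsub>G\<^esub>\<rparr>"
  have "group H"
  proof (rule groupI)
    fix x assume "x \<in> carrier H"
    then obtain a where a: "a \<in> carrier G" "x = f a"
      by (auto simp: H_def)
    then have "f (inv\<^bsub>G\<^esub> a) \<in> carrier H" "f (inv\<^bsub>G\<^esub> a) \<otimes>\<^bsub>H\<^esub> x = \<one>\<^bsub>H\<^esub>"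
      by (auto simp: H_def)
    then show "\<exists>y\<in>carrier H. y \<otimes>\<^bsub>H\<^esub> x = \<one>\<^bsub>H\<^esub>" by blast
  qed (auto simp: H_def m_assoc)
  moreover have "f \<in> iso G H"
    using f by (auto simp: iso_iff hom_def H_def)
  ultimately show thesis
    using that is_isoI by blast
qed

lemma first_order_rigid_any_type:
  fixes H :: "('b, 'n) monoid_scheme"
  assumes rigid: "first_order_rigid G" and H: "finitely_generated_group H"
    and eq: "elementarily_equivalent H G"
  shows "H \<cong> G"
proof -
  have gH: "group H"
    using H by (simp add: finitely_generated_group_def)
  obtain K :: "nat monoid" where K: "group K" "H \<cong> K"
    using countable_group_iso_nat[OF gH finitely_generated_imp_countable[OF H]] by blast
  have "elementarily_equivalent K G"
    using iso_imp_elementarily_equivalent[OF gH K] eq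
    by (simp add: elementarily_equivalent_def)
  then have "K \<cong> G"
    using rigid finitely_generated_group_iso[OF H K] by (simp add: first_order_rigid_def)
  with K show ?thesis
    using iso_trans by blast
qed


section \<open>Semidirect products\<close>

definition semidirect_product ::
  "('a, 'm) monoid_scheme \<Rightarrow> ('b \<Rightarrow> 'a \<Rightarrow> 'a) \<Rightarrow> ('b, 'n) monoid_scheme \<Rightarrow> ('a \<times> 'b) monoid" where
  "semidirect_product N \<rho> H =
     \<lparr>carrier = carrier N \<times> carrier H,
      monoid.mult = (\<lambda>(a, x) (b, y). (a \<otimes>\<^bsub>N\<^esub> \<rho> x b, x \<otimes>\<^bsub>H\<^esub> y)),
      one = (\<one>\<^bsub>N\<^esub>, \<one>\<^bsub>H\<^esub>)\<rparr>"

context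
  fixes N :: "('a, 'm) monoid_scheme" and H :: "('b, 'n) monoid_scheme"
    and \<rho> :: "'b \<Rightarrow> 'a \<Rightarrow> 'a"
  assumes N: "group N" and H: "group H" and \<rho>: "\<rho> \<in> hom H (AutoGroup N)"
begin

interpretation N: group N by (rule N)
interpretation H: group H by (rule H)

lemma action_hom: "x \<in> carrier H \<Longrightarrow> \<rho> x \<in> hom N N"
  using hom_in_carrier[OF \<rho>, of x] by (simp add: AutoGroup_def auto_def)

lemma action_closed: "x \<in> carrier H \<Longrightarrow> a \<in> carrier N \<Longrightarrow> \<rho> x a \<in> carrier N"
  using action_hom by (rule hom_in_carrier)

lemma action_act_mult:
  "x \<in> carrier H \<Longrightarrow> a \<in> carrier N \<Longrightarrow> b \<in> carrier N \<Longrightarrow> \<rho> x (a \<otimes>\<^bsub>N\<^esub> b) = \<rho> x a \<otimes>\<^bsub>N\<^esub> \<rho> x b"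
  using action_hom by (rule hom_mult)

lemma action_act_one: "x \<in> carrier H \<Longrightarrow> \<rho> x \<one>\<^bsub>N\<^esub> = \<one>\<^bsub>N\<^esub>"
  by (rule hom_one[OF action_hom N N])

lemma action_one: "a \<in> carrier N \<Longrightarrow> \<rho> \<one>\<^bsub>H\<^esub> a = a"
  using hom_one[OF \<rho> H N.AutoGroup] by (simp add: AutoGroup_def BijGroup_def)

lemma action_mult:
  assumes "x \<in> carrier H" "y \<in> carrier H" "a \<in> carrier N"
  shows "\<rho> (x \<otimes>\<^bsub>H\<^esub> y) a = \<rho> x (\<rho> y a)"
proof -
  have "\<rho> x \<in> Bij (carrier N)" "\<rho> y \<in> Bij (carrier N)"
    using hom_in_carrier[OF \<rho>] assms by (auto simp: AutoGroup_def auto_def)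
  then show ?thesis
    using hom_mult[OF \<rho>, of x y] assms by (simp add: AutoGroup_def BijGroup_def compose_def)
qed

lemma group_semidirect_product: "group (semidirect_product N \<rho> H)"
proof (rule groupI)
  fix p assume "p \<in> carrier (semidirect_product N \<rho> H)"
  then obtain a x where p: "p = (a, x)" "a \<in> carrier N" "x \<in> carrier H"
    by (auto simp: semidirect_product_def)
  let ?q = "(\<rho> (inv\<^bsub>H\<^esub> x) (inv\<^bsub>N\<^esub> a), inv\<^bsub>H\<^esub> x)"
  have "?q \<in> carrier (semidirect_product N \<rho> H)"
    using p by (simp add: semidirect_product_def action_closed)
  moreover have "?q \<otimes>\<^bsub>semidirect_product N \<rho> H\<^esub> p = \<one>\<^bsub>semidirect_product N \<rho> H\<^esub>"
    using p by (simp add: semidirect_product_def action_act_one flip: action_act_mult)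
  ultimately show "\<exists>q\<in>carrier (semidirect_product N \<rho> H).
      q \<otimes>\<^bsub>semidirect_product N \<rho> H\<^esub> p = \<one>\<^bsub>semidirect_product N \<rho> H\<^esub>"
    by blast
qed (auto simp: semidirect_product_def action_closed action_act_mult action_one action_mult
       N.m_assoc H.m_assoc)

lemma finitely_generated_semidirect_product:
  assumes "finitely_generated_group N" "finitely_generated_group H"
  shows "finitely_generated_group (semidirect_product N \<rho> H)" (is "finitely_generated_group ?P")
proof -
  obtain S where S: "finite S" "S \<subseteq> carrier N" "generate N S = carrier N"
    using assms by (auto simp: finitely_generated_group_def)
  obtain T where T: "finite T" "T \<subseteq> carrier H" "generate H T = carrier H"
    using assms by (auto simp: finitely_generated_group_def)
  define i :: "'a \<Rightarrow> 'a \<times> 'b" where "i = (\<lambda>a. (a, \<one>\<^bsub>H\<^esub>))"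
  define j :: "'b \<Rightarrow> 'a \<times> 'b" where "j = (\<lambda>x. (\<one>\<^bsub>N\<^esub>, x))"
  interpret P: group ?P by (rule group_semidirect_product)
  interpret i: group_hom N ?P i
    by unfold_locales (auto simp: i_def hom_def semidirect_product_def action_one)
  interpret j: group_hom H ?P j
    by unfold_locales (auto simp: j_def hom_def semidirect_product_def action_act_one)
  let ?U = "i ` S \<union> j ` T"
  have U: "?U \<subseteq> carrier ?P"
    using S(2) T(2) by auto
  have "carrier ?P \<subseteq> generate ?P ?U"
  proof
    fix p assume "p \<in> carrier ?P"
    then obtain a x where p: "p = (a, x)" "a \<in> carrier N" "x \<in> carrier H"
      by (auto simp: semidirect_product_def)
    have "i a \<in> generate ?P (i ` S)"
      unfolding i.generate_img[OF S(2)] S(3) using p(2) by (rule imageI)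
    then have "i a \<in> generate ?P ?U"
      by (rule subsetD[OF P.mono_generate, rotated]) simp
    moreover have "j x \<in> generate ?P (j ` T)"
      unfolding j.generate_img[OF T(2)] T(3) using p(3) by (rule imageI)
    then have "j x \<in> generate ?P ?U"
      by (rule subsetD[OF P.mono_generate, rotated]) simp
    ultimately have "i a \<otimes>\<^bsub>?P\<^esub> j x \<in> generate ?P ?U"
      by (rule generate.eng)
    moreover have "i a \<otimes>\<^bsub>?P\<^esub> j x = p"
      using p by (simp add: i_def j_def semidirect_product_def action_one)
    ultimately show "p \<in> generate ?P ?U"
      by simp
  qed
  then have "generate ?P ?U = carrier ?P"
    using P.generate_incl[OF U] by (simp only: equalityI)
  then show ?thesis
    unfolding finitely_generated_group_def using S(1) T(1) U P.is_group
    by (intro conjI exI[of _ ?U]) simp_all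
qed

end


section \<open>The group \<open>G\<^sub>6\<close>\<close>

abbreviation C25 :: "int monoid" where
  "C25 \<equiv> integer_mod_group 25"

text \<open>Elements of \<^const>\<open>AutoGroup\<close> are extensional functions, hence the restriction
  to the carrier.\<close>

definition \<alpha>6 :: "int \<Rightarrow> int" where
  "\<alpha>6 = (\<lambda>x \<in> carrier C25. x [^]\<^bsub>C25\<^esub> (6::nat))"

definition \<rho>6 :: "int \<Rightarrow> int \<Rightarrow> int" where
  "\<rho>6 n = \<alpha>6 [^]\<^bsub>AutoGroup C25\<^esub> n"

definition G6 :: "(int \<times> int) monoid" where
  "G6 = semidirect_product C25 \<rho>6 integer_group"

lemma \<alpha>6_automorphism: "\<alpha>6 \<in> carrier (AutoGroup C25)"
proof -
  have dom: "carrier C25 = {0..<25}"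
    by (simp add: carrier_integer_mod_group)
  have eq: "\<alpha>6 x = (6 * x) mod 25" if "x \<in> {0..<25}" for x
    using that by (simp add: \<alpha>6_def dom)
  have inj: "inj_on \<alpha>6 {0..<25}"
  proof (rule inj_on_inverseI)
    fix x :: int assume x: "x \<in> {0..<25}"
    have "(21 * \<alpha>6 x) mod 25 = (x + 25 * (5 * x)) mod 25"
      by (simp add: eq[OF x] mod_simps)
    also have "\<dots> = x"
      using x by (simp only: mod_mult_self2) simp
    finally show "(21 * \<alpha>6 x) mod 25 = x" .
  qed
  have "\<alpha>6 ` {0..<25} \<subseteq> {0..<25}"
    by (simp add: image_subset_iff eq)
  then have "bij_betw \<alpha>6 {0..<25} {0..<25}"
    using inj by (simp add: bij_betw_def endo_inj_surj)
  moreover have "\<alpha>6 \<in> hom C25 C25"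
  proof (rule homI)
    fix x y assume "x \<in> carrier C25" "y \<in> carrier C25"
    then have "x \<in> {0..<25}" "y \<in> {0..<25}"
      by (simp_all only: dom)
    moreover from this have "(x + y) mod 25 \<in> {0..<25}"
      by simp
    ultimately show "\<alpha>6 (x \<otimes>\<^bsub>C25\<^esub> y) = \<alpha>6 x \<otimes>\<^bsub>C25\<^esub> \<alpha>6 y"
      by (simp only: mult_integer_mod_group eq of_nat_numeral) (simp add: mod_simps distrib_left)
  qed (simp only: dom eq, simp)
  moreover have "\<alpha>6 \<in> extensional (carrier C25)"
    by (simp add: \<alpha>6_def)
  ultimately show ?thesis
    by (simp add: AutoGroup_def auto_def Bij_def dom)
qed

lemma \<rho>6_hom: "\<rho>6 \<in> hom integer_group (AutoGroup C25)"
  using group.hom_integer_group_pow[OF group.AutoGroup \<alpha>6_automorphism]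
  unfolding \<rho>6_def[abs_def] by simp

lemma \<rho>6_1: "\<rho>6 1 = \<alpha>6"
  unfolding \<rho>6_def by (rule group.int_pow_1[OF group.AutoGroup \<alpha>6_automorphism]) simp

lemma finitely_generated_G6: "finitely_generated_group G6"
proof -
  have "generate C25 (carrier C25) = carrier C25"
    by (intro equalityI group.generate_incl subsetI generate.incl) simp_all
  then have "finitely_generated_group C25"
    unfolding finitely_generated_group_def
    by (intro conjI exI[of _ "carrier C25"]) (simp_all add: carrier_integer_mod_group)
  moreover have "finitely_generated_group integer_group"
  proof -
    obtain x where "subgroup_generated integer_group {x} = integer_group"
      using cyclic_integer_group unfolding cyclic_group_def by blast
    then have "generate integer_group {x} = carrier integer_group"
      using carrier_subgroup_generated[of integer_group "{x}"] by simp
    then show ?thesis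
      unfolding finitely_generated_group_def
      by (intro conjI exI[of _ "{x}"]) auto
  qed
  ultimately show ?thesis
    unfolding G6_def
    by (intro finitely_generated_semidirect_product \<rho>6_hom) simp_all
qed

end

theory Submission
  imports Defs "HOL-Number_Theory.Cong"
begin

text \<open>The competitor is \<open>C\<^sub>2\<^sub>5 \<rtimes> \<int>\<close> with 1 acting by \<open>\<alpha>\<^sub>6\<^sup>2\<close>. As \<open>\<alpha>\<^sub>6\<close> has order 5, the action only
  involves residues modulo 5, and multiplication by 2 modulo 5 lifts to multiplication by a unit
  modulo every multiple of 5. First order sentences about the group \<open>\<int>\<close> do not distinguish such a
  multiplication from an automorphism, because each of them only sees finitely many residues and
  finitely many linear relations. Hence both groups satisfy the same sentences. They are not
  isomorphic, since the only automorphisms of \<open>\<int>\<close> itself are \<open>1\<close> and \<open>-1\<close>.\<close>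

section \<open>Partially similar integer tuples\<close>

text \<open>Add to \<open>u\<close> the multiple \<open>d * P\<close>, where \<open>P\<close> is the
  product of the primes of \<open>m\<close> not dividing \<open>u\<close>. Each prime of
  \<open>m\<close> then divides exactly one of \<open>u\<close> and \<open>d * P\<close>, hence not
  the sum. This lifts a unit modulo \<open>d\<close> to a unit modulo any nonzero
  \<open>m\<close>.\<close>

lemma exists_coprime_cong:
  fixes u d m :: int
  assumes "coprime u d" "m \<noteq> 0"
  obtains w where "[w = u] (mod d)" "coprime w m"
proof -
  define P where "P = \<Prod>{p \<in> prime_factors m. \<not> p dvd u}"
  have P: "p dvd P \<longleftrightarrow> \<not> p dvd u" if p: "Factorial_Ring.prime p" "p dvd m" for p
  proof
    assume "p dvd P"
    then obtain q where q: "q \<in> prime_factors m" "\<not> q dvd u" "p dvd q"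
      using prime_dvd_prod_iff[of "{p \<in> prime_factors m. \<not> p dvd u}" p "\<lambda>p. p"] p(1)
      by (auto simp: P_def)
    then have "p = q"
      using primes_dvd_imp_eq p(1) in_prime_factors_imp_prime by blast
    with q show "\<not> p dvd u" by simp
  next
    assume "\<not> p dvd u"
    then have "p \<in> {p \<in> prime_factors m. \<not> p dvd u}"
      using that assms by (simp add: in_prime_factors_iff)
    then show "p dvd P"
      unfolding P_def by (intro dvd_prodI) simp_all
  qed
  have "coprime (u + d * P) m"
  proof (rule ccontr)
    assume "\<not> coprime (u + d * P) m"
    then have "\<not> is_unit (gcd (u + d * P) m)"
      unfolding is_unit_gcd .
    moreover have "gcd (u + d * P) m \<noteq> 0"
      using assms by simp
    ultimately obtain p where p: "p dvd gcd (u + d * P) m" "Factorial_Ring.prime p"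
      using prime_divisor_exists by blast
    then have m: "p dvd m" and uP: "p dvd u + d * P"
      by simp_all
    show False
    proof (cases "p dvd u")
      case True
      then have "p dvd d * P"
        using uP by (simp add: dvd_add_right_iff)
      then have "p dvd d"
        using P[OF p(2) m] True p(2) by (simp add: prime_dvd_mult_iff)
      with True show False
        using assms(1) p(2) coprime_common_divisor not_prime_unit by blast
    next
      case False
      then show False
        using uP P[OF p(2) m] by (simp add: dvd_add_left_iff)
    qed
  qed
  then show thesis
    using that[of "u + d * P"] by (simp add: cong_def)
qed

text \<open>Position of the back-and-forth game: to precision \<open>M\<close>, \<open>x\<close>
  looks like \<open>y\<close> multiplied by \<open>w\<close>, and linear relations with coefficients
  up to \<open>B\<close> agree. Carrying the intended inverse \<open>v\<close> along makes the
  notion symmetric under swapping the two sides.\<close>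

definition similar ::
  "int \<Rightarrow> int \<Rightarrow> nat \<Rightarrow> int \<Rightarrow> 'i set \<Rightarrow> ('i \<Rightarrow> int) \<Rightarrow> ('i \<Rightarrow> int) \<Rightarrow> bool" where
  "similar w v B M I x y \<longleftrightarrow>
     (\<forall>i\<in>I. [x i = w * y i] (mod M) \<and> [y i = v * x i] (mod M)) \<and>
     (\<forall>c. (\<forall>i\<in>I. \<bar>c i\<bar> \<le> int B) \<longrightarrow> ((\<Sum>i\<in>I. c i * x i) = 0 \<longleftrightarrow> (\<Sum>i\<in>I. c i * y i) = 0))"

lemma similar_sum_eq_0_iff:
  assumes "similar w v B M I x y" "\<And>i. i \<in> I \<Longrightarrow> \<bar>c i\<bar> \<le> int B"
  shows "(\<Sum>i\<in>I. c i * x i) = 0 \<longleftrightarrow> (\<Sum>i\<in>I. c i * y i) = 0"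
  using assms by (simp add: similar_def)

lemma similar_sym: "similar w v B M I x y \<longleftrightarrow> similar v w B M I y x"
  by (auto simp: similar_def)

lemma similar_empty: "similar w v B M {} x y"
  by (simp add: similar_def)

lemma similar_mono:
  assumes xy: "similar w v B M I x y" and "finite I" "J \<subseteq> I" "C \<le> B" "L dvd M"
  shows "similar w v C L J x y"
  unfolding similar_def
proof (intro conjI ballI allI impI)
  fix i assume "i \<in> J"
  with assms show "[x i = w * y i] (mod L)" "[y i = v * x i] (mod L)"
    unfolding similar_def by (meson cong_dvd_modulus subsetD)+
next
  fix c assume c: "\<forall>i\<in>J. \<bar>c i\<bar> \<le> int C"
  \<comment> \<open>A relation on \<open>J\<close> is a relation on \<open>I\<close> padded with
    zero coefficients.\<close>
  define c' where "c' i = (if i \<in> J then c i else 0)" for i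
  have "(\<Sum>i\<in>I. c' i * z i) = (\<Sum>i\<in>J. c i * z i)" for z :: "'a \<Rightarrow> int"
    using assms by (intro sum.mono_neutral_cong_right) (auto simp: c'_def)
  moreover have "\<forall>i\<in>I. \<bar>c' i\<bar> \<le> int B"
    using c \<open>C \<le> B\<close> by (fastforce simp: c'_def)
  ultimately show "(\<Sum>i\<in>J. c i * x i) = 0 \<longleftrightarrow> (\<Sum>i\<in>J. c i * y i) = 0"
    using xy unfolding similar_def by metis
qed

text \<open>Relations in which the new coordinate has coefficient 0 are inherited from
  \<open>xy\<close>, so only \<open>k \<noteq> 0\<close> has to be checked.\<close>

lemma similar_insert:
  assumes "finite I" "n \<notin> I" and xy: "similar w v B M I x y"
    and z: "[z = w * z'] (mod M)" "[z' = v * z] (mod M)"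
    and lin: "\<And>k c. k \<noteq> 0 \<Longrightarrow> \<bar>k\<bar> \<le> int B \<Longrightarrow> (\<And>i. i \<in> I \<Longrightarrow> \<bar>c i\<bar> \<le> int B) \<Longrightarrow>
      k * z + (\<Sum>i\<in>I. c i * x i) = 0 \<longleftrightarrow> k * z' + (\<Sum>i\<in>I. c i * y i) = 0"
  shows "similar w v B M (insert n I) (x(n := z)) (y(n := z'))"
proof -
  have "(\<Sum>i\<in>I. c i * (a(n := b)) i) = (\<Sum>i\<in>I. c i * a i)" for a c :: "'a \<Rightarrow> int" and b
    using \<open>n \<notin> I\<close> by (intro sum.cong) auto
  moreover have "c n * z + (\<Sum>i\<in>I. c i * x i) = 0 \<longleftrightarrow> c n * z' + (\<Sum>i\<in>I. c i * y i) = 0"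
    if "\<forall>i\<in>insert n I. \<bar>c i\<bar> \<le> int B" for c
    using that xy lin[of "c n" c] by (cases "c n = 0") (auto simp: similar_def)
  ultimately show ?thesis
    using assms(1-5) by (auto simp: similar_def simp del: fun_upd_apply)
      (auto simp: fun_upd_def)
qed

text \<open>If \<open>z\<close> satisfies a relation \<open>k z + \<Sum> c\<^sub>i x\<^sub>i = 0\<close> with small coefficients, its partner is
  forced; otherwise any sufficiently large number in the right residue class will do.\<close>

lemma similar_extend:
  assumes I: "finite I" "n \<notin> I" and "M > 0" and wv: "[w * v = 1] (mod M)"
    and xy: "similar w v (2 * B * B) (M * fact B) I x y"
  obtains z' where "similar w v B M (insert n I) (x(n := z)) (y(n := z'))"
proof -
  have xy': "similar w v B M I x y"
    using similar_mono[OF xy I(1) order_refl, of B M] by simp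
  have wz: "[z = w * z'] (mod M)" if "[z' = v * z] (mod M)" for z'
  proof -
    have "[w * z' = w * (v * z)] (mod M)"
      using that by (rule cong_scalar_left)
    also have "w * (v * z) = (w * v) * z" by simp
    also have "[(w * v) * z = 1 * z] (mod M)"
      using wv by (rule cong_scalar_right)
    finally show ?thesis by (simp add: cong_sym_eq)
  qed
  show thesis
  proof (cases "\<exists>k c. k \<noteq> 0 \<and> \<bar>k\<bar> \<le> int B \<and> (\<forall>i\<in>I. \<bar>c i\<bar> \<le> int B) \<and> k * z + (\<Sum>i\<in>I. c i * x i) = 0")
    case True
    then obtain k c where k: "k \<noteq> 0" "\<bar>k\<bar> \<le> int B" and c: "\<And>i. i \<in> I \<Longrightarrow> \<bar>c i\<bar> \<le> int B"
      and kz: "k * z + (\<Sum>i\<in>I. c i * x i) = 0"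
      by blast
    have "nat \<bar>k\<bar> dvd fact B"
      using k by (intro dvd_fact) auto
    then have "int (nat \<bar>k\<bar>) dvd int (fact B)"
      by (simp only: of_nat_dvd_iff)
    then have "k dvd fact B"
      by simp
    then obtain q where q: "fact B = k * q" by (rule dvdE)
    have "[(\<Sum>i\<in>I. c i * y i) = (\<Sum>i\<in>I. c i * (v * x i))] (mod M * fact B)"
      using xy by (intro cong_sum cong_scalar_left) (simp add: similar_def)
    also have "(\<Sum>i\<in>I. c i * (v * x i)) = v * (\<Sum>i\<in>I. c i * x i)"
      by (simp add: sum_distrib_left ac_simps)
    also have "\<dots> = k * (- v * z)"
    proof -
      have "(\<Sum>i\<in>I. c i * x i) = - (k * z)"
        using kz by simp
      then show ?thesis by simp
    qed
    finally obtain r where r: "(\<Sum>i\<in>I. c i * y i) = k * (- v * z) + r * (M * fact B)"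
      by (metis cong_iff_lin cong_sym mult.commute)
    \<comment> \<open>Solution of \<open>k * z' + (\<Sum>i\<in>I. c i * y i) = 0\<close>. The error
      \<open>r * (M * fact B)\<close> is divisible by \<open>k\<close>, as
      \<open>fact B = k * q\<close>, and the quotient is still a multiple of \<open>M\<close>; hence
      the sharper modulus in the hypothesis.\<close>
    define z' where "z' = v * z - r * M * q"
    have kz': "k * z' + (\<Sum>i\<in>I. c i * y i) = 0"
      unfolding r q z'_def by (simp add: algebra_simps)
    have z': "[z' = v * z] (mod M)"
      by (simp add: z'_def cong_iff_dvd_diff)
    show thesis
    proof (rule that, rule similar_insert[OF I xy' wz[OF z'] z'])
      fix l b assume l: "\<bar>l\<bar> \<le> int B" and b: "\<And>i. i \<in> I \<Longrightarrow> \<bar>b i\<bar> \<le> int B"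
      \<comment> \<open>Any second relation is compared with the chosen one by eliminating
        \<open>z\<close>. The result involves only the old coordinates, with coefficients up to
        \<open>2 * B * B\<close>.\<close>
      have "\<bar>k * b i - l * c i\<bar> \<le> int (2 * B * B)" if "i \<in> I" for i
      proof -
        have "\<bar>k * b i - l * c i\<bar> \<le> \<bar>k\<bar> * \<bar>b i\<bar> + \<bar>l\<bar> * \<bar>c i\<bar>"
          using abs_triangle_ineq4[of "k * b i" "l * c i"] by (simp add: abs_mult)
        also have "\<dots> \<le> int B * int B + int B * int B"
          using k(2) l b[OF that] c[OF that] by (intro add_mono mult_mono) auto
        finally show ?thesis by simp
      qed
      then have "(\<Sum>i\<in>I. (k * b i - l * c i) * x i) = 0 \<longleftrightarrow> (\<Sum>i\<in>I. (k * b i - l * c i) * y i) = 0"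
        by (rule similar_sum_eq_0_iff[OF xy])
      moreover have "l * t + (\<Sum>i\<in>I. b i * s i) = 0 \<longleftrightarrow> (\<Sum>i\<in>I. (k * b i - l * c i) * s i) = 0"
        if t: "k * t + (\<Sum>i\<in>I. c i * s i) = 0" for t s
      proof -
        have "(\<Sum>i\<in>I. (k * b i - l * c i) * s i) = k * (\<Sum>i\<in>I. b i * s i) - l * (\<Sum>i\<in>I. c i * s i)"
          by (simp add: left_diff_distrib sum_subtractf sum_distrib_left mult.assoc)
        also have "(\<Sum>i\<in>I. c i * s i) = - (k * t)"
          using t by simp
        finally have "(\<Sum>i\<in>I. (k * b i - l * c i) * s i) = k * (l * t + (\<Sum>i\<in>I. b i * s i))"
          by (simp add: algebra_simps)
        then show ?thesis
          using k(1) by simp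
      qed
      ultimately show "l * z + (\<Sum>i\<in>I. b i * x i) = 0 \<longleftrightarrow> l * z' + (\<Sum>i\<in>I. b i * y i) = 0"
        using kz kz' by blast
    qed
  next
    case False
    \<comment> \<open>\<open>L\<close> bounds every small combination of the \<open>y i\<close>, so
      no \<open>z'\<close> beyond it satisfies a relation with \<open>k \<noteq> 0\<close>.\<close>
    define L where "L = (\<Sum>i\<in>I. int B * \<bar>y i\<bar>)"
    define z' where "z' = v * z + M * (L + 1 + \<bar>v * z\<bar>)"
    have "L \<ge> 0"
      unfolding L_def by (intro sum_nonneg) simp
    then have "1 * (L + 1 + \<bar>v * z\<bar>) \<le> M * (L + 1 + \<bar>v * z\<bar>)"
      using \<open>M > 0\<close> by (intro mult_right_mono) auto
    moreover have "L < v * z + (L + 1 + \<bar>v * z\<bar>)"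
      by linarith
    ultimately have large: "z' > L"
      by (simp only: z'_def mult_1)
    have z': "[z' = v * z] (mod M)"
      unfolding z'_def cong_def by (rule mod_mult_self2)
    show thesis
    proof (rule that, rule similar_insert[OF I xy' wz[OF z'] z'])
      fix k c assume k: "k \<noteq> 0" "\<bar>k\<bar> \<le> int B" and c: "\<And>i. i \<in> I \<Longrightarrow> \<bar>c i\<bar> \<le> int B"
      have "\<bar>\<Sum>i\<in>I. c i * y i\<bar> \<le> (\<Sum>i\<in>I. \<bar>c i * y i\<bar>)"
        by (rule sum_abs)
      also have "\<dots> \<le> L"
        unfolding L_def using c by (intro sum_mono) (simp add: abs_mult mult_right_mono)
      also have "\<dots> < 1 * \<bar>z'\<bar>"
        using large by simp
      also have "\<dots> \<le> \<bar>k\<bar> * \<bar>z'\<bar>"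
        using k by (intro mult_right_mono) auto
      finally have "\<bar>\<Sum>i\<in>I. c i * y i\<bar> < \<bar>k * z'\<bar>"
        by (simp add: abs_mult)
      then have "k * z' + (\<Sum>i\<in>I. c i * y i) \<noteq> 0"
        by linarith
      with False k c show "k * z + (\<Sum>i\<in>I. c i * x i) = 0 \<longleftrightarrow> k * z' + (\<Sum>i\<in>I. c i * y i) = 0"
        by blast
    qed
  qed
qed

section \<open>Twisting the action of the integers\<close>

fun exponent_sum :: "group_term \<Rightarrow> nat \<Rightarrow> int" where
  "exponent_sum (TVar n) i = (if i = n then 1 else 0)"
| "exponent_sum TOne i = 0"
| "exponent_sum (TMult s t) i = exponent_sum s i + exponent_sum t i"
| "exponent_sum (TInv t) i = - exponent_sum t i"

lemma finite_term_vars: "finite (term_vars t)"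
  by (induction t) auto

lemma finite_free_vars: "finite (free_vars \<phi>)"
  by (induction \<phi>) (auto simp: finite_term_vars)

context
  fixes N :: "('a, 'm) monoid_scheme" and \<rho> :: "int \<Rightarrow> 'a \<Rightarrow> 'a"
  assumes N: "group N" and \<rho>: "\<rho> \<in> hom integer_group (AutoGroup N)"
begin

interpretation N: group N by (rule N)

lemma twisted_action_hom: "(\<lambda>n. \<rho> (u * n)) \<in> hom integer_group (AutoGroup N)"
  using hom_in_carrier[OF \<rho>] hom_mult[OF \<rho>] by (auto simp: hom_def distrib_left)

lemma semidirect_carrier:
  "carrier (semidirect_product N \<rho> integer_group) = carrier N \<times> UNIV"
  by (simp add: semidirect_product_def)

lemma semidirect_mult:
  "(a, x) \<otimes>\<^bsub>semidirect_product N \<rho> integer_group\<^esub> (b, y) = (a \<otimes>\<^bsub>N\<^esub> \<rho> x b, x + y)"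
  by (simp add: semidirect_product_def)

lemma semidirect_one: "\<one>\<^bsub>semidirect_product N \<rho> integer_group\<^esub> = (\<one>\<^bsub>N\<^esub>, 0)"
  by (simp add: semidirect_product_def)

lemma semidirect_inv:
  assumes "a \<in> carrier N"
  shows "inv\<^bsub>semidirect_product N \<rho> integer_group\<^esub> (a, x) = (\<rho> (- x) (inv\<^bsub>N\<^esub> a), - x)"
proof (rule group.inv_equality[OF group_semidirect_product[OF N group_integer_group \<rho>]])
  have "\<rho> (- x) (inv\<^bsub>N\<^esub> a) \<otimes>\<^bsub>N\<^esub> \<rho> (- x) a = \<one>\<^bsub>N\<^esub>"
    using assms action_act_mult[OF N group_integer_group \<rho>, of "- x" "inv\<^bsub>N\<^esub> a" a]
      action_act_one[OF N group_integer_group \<rho>, of "- x"] by simp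
  then show "(\<rho> (- x) (inv\<^bsub>N\<^esub> a), - x) \<otimes>\<^bsub>semidirect_product N \<rho> integer_group\<^esub> (a, x) =
      \<one>\<^bsub>semidirect_product N \<rho> integer_group\<^esub>"
    by (simp add: semidirect_mult semidirect_one)
qed (use assms action_closed[OF N group_integer_group \<rho>] in \<open>auto simp: semidirect_carrier\<close>)

text \<open>Projection to \<int> is a homomorphism into an abelian group, so only exponent sums
  matter. The action does not enter, so the same formula serves the original and the twisted
  group.\<close>

lemma snd_eval_term:
  assumes e: "range e \<subseteq> carrier N \<times> UNIV" and I: "finite I" "term_vars t \<subseteq> I"
  shows "snd (eval_term (semidirect_product N \<rho> integer_group) e t) =
    (\<Sum>i\<in>I. exponent_sum t i * snd (e i))"
  using I(2)
proof (induction t)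
  case (TVar n)
  then show ?case
    using I(1) by (simp add: if_distrib[of "\<lambda>x. x * _"] cong: if_cong)
next
  case (TMult s t)
  then show ?case
    by (simp add: semidirect_product_def case_prod_unfold distrib_right sum.distrib)
next
  case (TInv t)
  have "eval_term (semidirect_product N \<rho> integer_group) e t \<in> carrier N \<times> UNIV"
    using eval_term_closed[OF group_semidirect_product[OF N group_integer_group \<rho>], of e t] e
    by (simp add: semidirect_carrier)
  then obtain a x where "eval_term (semidirect_product N \<rho> integer_group) e t = (a, x)" "a \<in> carrier N"
    by blast
  with TInv show ?case
    by (simp add: semidirect_inv sum_negf)
qed (simp add: semidirect_one)

text \<open>The multiples of \<open>d\<close> lie in the kernel of \<open>\<rho>\<close>, so the
  action factors through residues modulo \<open>d\<close>.\<close>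

lemma action_cong:
  assumes "\<rho> d = \<one>\<^bsub>AutoGroup N\<^esub>" "[x = y] (mod d)"
  shows "\<rho> x = \<rho> y"
proof -
  interpret A: group "AutoGroup N" by (rule N.AutoGroup)
  interpret h: group_hom integer_group "AutoGroup N" \<rho>
    using \<rho> by (intro group_hom.intro group_hom_axioms.intro group_integer_group N.AutoGroup)
  obtain k where k: "y = x + d * k"
    using assms(2) by (auto simp: cong_iff_lin)
  have "\<rho> (d * k) = \<rho> (d [^]\<^bsub>integer_group\<^esub> k)"
    by (simp add: mult.commute)
  also have "\<dots> = \<rho> d [^]\<^bsub>AutoGroup N\<^esub> k"
    by (rule h.hom_int_pow) simp
  also have "\<dots> = \<one>\<^bsub>AutoGroup N\<^esub>"
    by (simp add: assms(1))
  finally show ?thesis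
    using h.hom_mult[of x "d * k"] h.hom_closed[of x] k by simp
qed

end

text \<open>Both claims go through one induction: the \<open>N\<close>-coordinate of a product
  depends on the automorphism given by a \<int>-coordinate. In \<open>H u\<close>, \<open>y\<close>
  acts as \<open>u * y\<close> does in \<open>G\<close>, which is why the congruence carries the
  factor \<open>u\<close>.\<close>

lemma fst_eval_term_twist:
  fixes N :: "('a, 'm) monoid_scheme" and \<rho> :: "int \<Rightarrow> 'a \<Rightarrow> 'a"
  defines "G \<equiv> semidirect_product N \<rho> integer_group"
    and "H \<equiv> \<lambda>u. semidirect_product N (\<lambda>n. \<rho> (u * n)) integer_group"
  assumes N: "group N" and \<rho>: "\<rho> \<in> hom integer_group (AutoGroup N)"
    and d: "\<rho> d = \<one>\<^bsub>AutoGroup N\<^esub>"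
    and e: "range e \<subseteq> carrier N \<times> UNIV" and f: "range f \<subseteq> carrier N \<times> UNIV"
    and ef: "\<And>i. i \<in> term_vars t \<Longrightarrow> fst (e i) = fst (f i) \<and> [snd (e i) = u * snd (f i)] (mod d)"
  shows "fst (eval_term G e t) = fst (eval_term (H u) f t) \<and>
    [snd (eval_term G e t) = u * snd (eval_term (H u) f t)] (mod d)"
  using ef
proof (induction t)
  case (TMult s t)
  then have "\<rho> (snd (eval_term G e s)) = \<rho> (u * snd (eval_term (H u) f s))"
    by (intro action_cong[OF N \<rho> d]) auto
  with TMult show ?case
    by (simp add: G_def H_def semidirect_product_def case_prod_unfold distrib_left cong_add)
next
  case (TInv t)
  note \<rho>u = twisted_action_hom[OF N \<rho>]
  have "eval_term G e t \<in> carrier N \<times> UNIV"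
    using eval_term_closed[OF group_semidirect_product[OF N group_integer_group \<rho>], of e t] e
    by (simp add: semidirect_product_def G_def)
  then obtain a x where ax: "eval_term G e t = (a, x)" "a \<in> carrier N"
    by blast
  obtain y where y: "eval_term (H u) f t = (a, y)" "[x = u * y] (mod d)"
    using TInv ax by (cases "eval_term (H u) f t") auto
  then have "[- x = u * - y] (mod d)"
    by (simp add: cong_minus_minus_iff)
  then show ?case
    using ax(2) action_cong[OF N \<rho> d, of "- x" "u * - y"]
    by (simp add: ax(1) y(1), simp add: G_def H_def semidirect_inv[OF N \<rho>] semidirect_inv[OF N \<rho>u])
qed (simp_all add: G_def H_def semidirect_product_def)

text \<open>In the Ehrenfeucht-Fraisse game, a formula only sees the \<open>N\<close>-coordinates, and the \<open>\<int>\<close>-coordinates up to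
  similarity to finite precision. The strength \<open>(B, M)\<close> depends on the formula only, while the
  multiplier \<open>w\<close>, a unit modulo \<open>M\<close>, stays the same through all rounds.\<close>

lemma satisfies_twist:
  fixes N :: "('a, 'm) monoid_scheme" and \<rho> :: "int \<Rightarrow> 'a \<Rightarrow> 'a"
  defines "G \<equiv> semidirect_product N \<rho> integer_group"
    and "H \<equiv> \<lambda>u. semidirect_product N (\<lambda>n. \<rho> (u * n)) integer_group"
  assumes N: "group N" and \<rho>: "\<rho> \<in> hom integer_group (AutoGroup N)"
    and d: "\<rho> d = \<one>\<^bsub>AutoGroup N\<^esub>" "d > 0"
  shows "\<exists>B M. M > 0 \<and> d dvd M \<and> (\<forall>w v e f.
    [w = u] (mod d) \<and> [w * v = 1] (mod M) \<and> range e \<subseteq> carrier N \<times> UNIV \<and> range f \<subseteq> carrier N \<times> UNIV \<and>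
    (\<forall>i\<in>free_vars \<phi>. fst (e i) = fst (f i)) \<and>
    similar w v B M (free_vars \<phi>) (snd \<circ> e) (snd \<circ> f) \<longrightarrow>
    (satisfies G e \<phi> \<longleftrightarrow> satisfies (H u) f \<phi>))"
proof (induction \<phi>)
  case (FEq s t)
  let ?I = "term_vars s \<union> term_vars t"
  have fin: "finite ?I" by (simp add: finite_term_vars)
  \<comment> \<open>The \<int>-coordinates of \<open>s\<close> and \<open>t\<close> agree exactly
    when the combination with coefficients \<open>b\<close> vanishes; \<open>B\<close> is chosen to
    bound all of these coefficients.\<close>
  define b where "b i = exponent_sum s i - exponent_sum t i" for i
  define B where "B = nat (\<Sum>i\<in>?I. \<bar>b i\<bar>)"
  have bB: "\<bar>b i\<bar> \<le> int B" if "i \<in> ?I" for i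
    unfolding B_def using that member_le_sum[of i ?I "\<lambda>i. \<bar>b i\<bar>"] fin by simp
  show ?case
  proof (intro exI[of _ B] exI[of _ d] conjI allI impI; (elim conjE)?)
    fix w v e f
    assume wu: "[w = u] (mod d)" and e: "range e \<subseteq> carrier N \<times> UNIV" and f: "range f \<subseteq> carrier N \<times> UNIV"
      and fst: "\<forall>i\<in>free_vars (FEq s t). fst (e i) = fst (f i)"
      and sim: "similar w v B d (free_vars (FEq s t)) (snd \<circ> e) (snd \<circ> f)"
    have "[snd (e i) = u * snd (f i)] (mod d)" if "i \<in> ?I" for i
    proof -
      have "[snd (e i) = w * snd (f i)] (mod d)"
        using sim that by (simp add: similar_def)
      also have "[w * snd (f i) = u * snd (f i)] (mod d)"
        using wu by (rule cong_scalar_right)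
      finally show ?thesis .
    qed
    with fst have "fst (eval_term G e r) = fst (eval_term (H u) f r)" if "r = s \<or> r = t" for r
      unfolding G_def H_def using that by (intro fst_eval_term_twist[OF N \<rho> d(1) e f, THEN conjunct1]) auto
    moreover have "snd (eval_term G e s) = snd (eval_term G e t) \<longleftrightarrow> (\<Sum>i\<in>?I. b i * snd (e i)) = 0"
      using snd_eval_term[OF N \<rho> e fin, of s] snd_eval_term[OF N \<rho> e fin, of t]
      by (simp add: G_def b_def left_diff_distrib sum_subtractf)
    moreover have "snd (eval_term (H u) f s) = snd (eval_term (H u) f t) \<longleftrightarrow> (\<Sum>i\<in>?I. b i * snd (f i)) = 0"
      using snd_eval_term[OF N twisted_action_hom[OF N \<rho>] f fin, of s]
        snd_eval_term[OF N twisted_action_hom[OF N \<rho>] f fin, of t]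
      by (simp add: H_def b_def left_diff_distrib sum_subtractf)
    moreover have "(\<Sum>i\<in>?I. b i * snd (e i)) = 0 \<longleftrightarrow> (\<Sum>i\<in>?I. b i * snd (f i)) = 0"
      using sim bB by (simp add: similar_def)
    ultimately show "satisfies G e (FEq s t) \<longleftrightarrow> satisfies (H u) f (FEq s t)"
      by (simp add: prod_eq_iff)
  qed (use d in simp_all)
next
  case (FNeg \<phi>)
  then show ?case by simp
next
  case (FConj \<phi> \<psi>)
  obtain B M where BM: "M > 0" "d dvd M" "\<And>w v e f.
    [w = u] (mod d) \<Longrightarrow> [w * v = 1] (mod M) \<Longrightarrow> range e \<subseteq> carrier N \<times> UNIV \<Longrightarrow> range f \<subseteq> carrier N \<times> UNIV \<Longrightarrow>
    \<forall>i\<in>free_vars \<phi>. fst (e i) = fst (f i) \<Longrightarrow>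
    similar w v B M (free_vars \<phi>) (snd \<circ> e) (snd \<circ> f) \<Longrightarrow>
    (satisfies G e \<phi> \<longleftrightarrow> satisfies (H u) f \<phi>)"
    using FConj.IH(1) by blast
  obtain C L where CL: "L > 0" "d dvd L" "\<And>w v e f.
    [w = u] (mod d) \<Longrightarrow> [w * v = 1] (mod L) \<Longrightarrow> range e \<subseteq> carrier N \<times> UNIV \<Longrightarrow> range f \<subseteq> carrier N \<times> UNIV \<Longrightarrow>
    \<forall>i\<in>free_vars \<psi>. fst (e i) = fst (f i) \<Longrightarrow>
    similar w v C L (free_vars \<psi>) (snd \<circ> e) (snd \<circ> f) \<Longrightarrow>
    (satisfies G e \<psi> \<longleftrightarrow> satisfies (H u) f \<psi>)"
    using FConj.IH(2) by blast
  show ?case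
  \<comment> \<open>The larger bound and the product of the moduli refine the requirements of both
    conjuncts.\<close>
  proof (intro exI[of _ "max B C"] exI[of _ "M * L"] conjI allI impI; (elim conjE)?)
    fix w v e f
    assume wu: "[w = u] (mod d)" and wv: "[w * v = 1] (mod M * L)"
      and e: "range e \<subseteq> carrier N \<times> UNIV" and f: "range f \<subseteq> carrier N \<times> UNIV"
      and fst: "\<forall>i\<in>free_vars (FConj \<phi> \<psi>). fst (e i) = fst (f i)"
      and sim: "similar w v (max B C) (M * L) (free_vars (FConj \<phi> \<psi>)) (snd \<circ> e) (snd \<circ> f)"
    have "satisfies G e \<phi> \<longleftrightarrow> satisfies (H u) f \<phi>"
      using fst by (intro BM(3)[OF wu cong_dvd_modulus[OF wv] e f _ similar_mono[OF sim finite_free_vars]]) auto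
    moreover have "satisfies G e \<psi> \<longleftrightarrow> satisfies (H u) f \<psi>"
      using fst by (intro CL(3)[OF wu cong_dvd_modulus[OF wv] e f _ similar_mono[OF sim finite_free_vars]]) auto
    ultimately show "satisfies G e (FConj \<phi> \<psi>) \<longleftrightarrow> satisfies (H u) f (FConj \<phi> \<psi>)"
      by simp
  qed (use BM(1,2) CL(1) in simp_all)
next
  case (FForall n \<phi>)
  obtain B M where BM: "M > 0" "d dvd M" "\<And>w v e f.
    [w = u] (mod d) \<Longrightarrow> [w * v = 1] (mod M) \<Longrightarrow> range e \<subseteq> carrier N \<times> UNIV \<Longrightarrow> range f \<subseteq> carrier N \<times> UNIV \<Longrightarrow>
    \<forall>i\<in>free_vars \<phi>. fst (e i) = fst (f i) \<Longrightarrow>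
    similar w v B M (free_vars \<phi>) (snd \<circ> e) (snd \<circ> f) \<Longrightarrow>
    (satisfies G e \<phi> \<longleftrightarrow> satisfies (H u) f \<phi>)"
    using FForall.IH by blast
  let ?I = "free_vars \<phi> - {n}"
  have I: "finite ?I" "n \<notin> ?I" "finite (insert n ?I)" "free_vars \<phi> \<subseteq> insert n ?I"
    by (auto simp: finite_free_vars)
  show ?case
  \<comment> \<open>Exactly the strength that \<open>similar_extend\<close> uses up in one round to
    leave \<open>(B, M)\<close> for the body.\<close>
  proof (intro exI[of _ "2 * B * B"] exI[of _ "M * fact B"] conjI allI impI; (elim conjE)?)
    fix w v e f
    assume wu: "[w = u] (mod d)" and wv': "[w * v = 1] (mod M * fact B)"
      and e: "range e \<subseteq> carrier N \<times> UNIV" and f: "range f \<subseteq> carrier N \<times> UNIV"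
      and fst: "\<forall>i\<in>free_vars (FForall n \<phi>). fst (e i) = fst (f i)"
      and "similar w v (2 * B * B) (M * fact B) (free_vars (FForall n \<phi>)) (snd \<circ> e) (snd \<circ> f)"
    then have sim: "similar w v (2 * B * B) (M * fact B) ?I (snd \<circ> e) (snd \<circ> f)"
      by simp
    have wv: "[w * v = 1] (mod M)" "[v * w = 1] (mod M)"
      using cong_dvd_modulus[OF wv', of M] by (simp_all add: mult.commute)
    have step: "satisfies G (e(n := (a, x))) \<phi> \<longleftrightarrow> satisfies (H u) (f(n := (a, y))) \<phi>"
      if "a \<in> carrier N" and xy: "similar w v B M (insert n ?I) ((snd \<circ> e)(n := x)) ((snd \<circ> f)(n := y))"
      for a x y
    proof (rule BM(3)[OF wu wv(1)])
      show "range (e(n := (a, x))) \<subseteq> carrier N \<times> UNIV" "range (f(n := (a, y))) \<subseteq> carrier N \<times> UNIV"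
        using e f \<open>a \<in> carrier N\<close> by auto
      show "\<forall>i\<in>free_vars \<phi>. fst ((e(n := (a, x))) i) = fst ((f(n := (a, y))) i)"
        using fst by auto
      show "similar w v B M (free_vars \<phi>) (snd \<circ> e(n := (a, x))) (snd \<circ> f(n := (a, y)))"
        using similar_mono[OF xy I(3,4) order_refl dvd_refl] by (simp add: fun_upd_comp)
    qed
    show "satisfies G e (FForall n \<phi>) \<longleftrightarrow> satisfies (H u) f (FForall n \<phi>)"
    proof
      assume L: "satisfies G e (FForall n \<phi>)"
      have "satisfies (H u) (f(n := (a, y))) \<phi>" if a: "a \<in> carrier N" for a y
      proof -
        \<comment> \<open>The answer to a move in \<open>H u\<close> is found with the roles of
          \<open>w\<close> and \<open>v\<close> exchanged.\<close>
        obtain x where "similar v w B M (insert n ?I) ((snd \<circ> f)(n := y)) ((snd \<circ> e)(n := x))"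
          using similar_extend[OF I(1,2) BM(1) wv(2)] sim similar_sym by blast
        then show ?thesis
          using step[OF a] L a by (simp add: similar_sym G_def semidirect_product_def)
      qed
      then show "satisfies (H u) f (FForall n \<phi>)"
        by (auto simp: H_def semidirect_product_def)
    next
      assume R: "satisfies (H u) f (FForall n \<phi>)"
      have "satisfies G (e(n := (a, x))) \<phi>" if a: "a \<in> carrier N" for a x
      proof -
        obtain y where "similar w v B M (insert n ?I) ((snd \<circ> e)(n := x)) ((snd \<circ> f)(n := y))"
          using similar_extend[OF I(1,2) BM(1) wv(1) sim] by blast
        then show ?thesis
          using step[OF a] R a by (simp add: H_def semidirect_product_def)
      qed
      then show "satisfies G e (FForall n \<phi>)"
        by (auto simp: G_def semidirect_product_def)
    qed
  qed (use BM(1,2) in simp_all)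
qed

theorem elementarily_equivalent_twist:
  fixes N :: "('a, 'm) monoid_scheme" and \<rho> :: "int \<Rightarrow> 'a \<Rightarrow> 'a"
  assumes N: "group N" and \<rho>: "\<rho> \<in> hom integer_group (AutoGroup N)"
    and d: "\<rho> d = \<one>\<^bsub>AutoGroup N\<^esub>" "d > 0" and u: "coprime u d"
  shows "elementarily_equivalent (semidirect_product N \<rho> integer_group)
    (semidirect_product N (\<lambda>n. \<rho> (u * n)) integer_group)" (is "elementarily_equivalent ?G ?H")
  unfolding elementarily_equivalent_def
proof (intro allI impI)
  fix \<phi> assume \<phi>: "is_sentence \<phi>"
  obtain B M where BM: "M > 0" "\<And>w v e f.
    [w = u] (mod d) \<Longrightarrow> [w * v = 1] (mod M) \<Longrightarrow> range e \<subseteq> carrier N \<times> UNIV \<Longrightarrow> range f \<subseteq> carrier N \<times> UNIV \<Longrightarrow>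
    \<forall>i\<in>free_vars \<phi>. fst (e i) = fst (f i) \<Longrightarrow>
    similar w v B M (free_vars \<phi>) (snd \<circ> e) (snd \<circ> f) \<Longrightarrow>
    (satisfies ?G e \<phi> \<longleftrightarrow> satisfies ?H f \<phi>)"
    using satisfies_twist[OF N \<rho> d, of u \<phi>] by blast
  \<comment> \<open>The sentence fixes \<open>M\<close> first; only then is \<open>u\<close> lifted
    to a unit modulo \<open>M\<close>. With no free variables the empty tuples are similar, so the
    game can start.\<close>
  obtain w where w: "[w = u] (mod d)" "coprime w M"
    using exists_coprime_cong[OF u, of M] BM(1) by auto
  obtain v where v: "[w * v = 1] (mod M)"
    using cong_solve_coprime_int[OF w(2)] by blast
  have eq: "satisfies ?G e \<phi> \<longleftrightarrow> satisfies ?H f \<phi>"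
    if "range e \<subseteq> carrier N \<times> UNIV" "range f \<subseteq> carrier N \<times> UNIV" for e f
    using BM(2)[OF w(1) v that] \<phi> by (simp add: is_sentence_def similar_empty)
  \<comment> \<open>\<open>holds_in\<close> quantifies over all assignments; transferring it needs
    at least one assignment on the other side.\<close>
  have "range (\<lambda>_. (\<one>\<^bsub>N\<^esub>, 0)) \<subseteq> carrier N \<times> (UNIV :: int set)"
    using monoid.one_closed[OF group.is_monoid[OF N]] by auto
  with eq show "holds_in ?G \<phi> \<longleftrightarrow> holds_in ?H \<phi>"
    unfolding holds_in_def semidirect_carrier[OF N \<rho>] semidirect_carrier[OF N twisted_action_hom[OF N \<rho>]]
    by blast
qed

section \<open>The group \<open>C\<^sub>2\<^sub>5 \<rtimes> \<int>\<close> with the squared action\<close>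

text \<open>Note that \<open>6\<^sup>n\<close> and \<open>1 + 5 n\<close> are congruent modulo 25.\<close>

lemma \<rho>6_eq:
  assumes "x \<in> {0..<25}"
  shows "\<rho>6 n x = ((1 + 5 * n) * x) mod 25"
proof -
  note C = group_integer_mod_group[of 25] group_integer_group \<rho>6_hom
  have car: "carrier C25 = {0..<25}"
    by (simp add: carrier_integer_mod_group)
  have step: "\<rho>6 (n + 1) x = \<rho>6 n (6 * x mod 25)" if "x \<in> {0..<25}" for n x
  proof -
    have "\<rho>6 (n + 1) x = \<rho>6 n (\<rho>6 1 x)"
      using action_mult[OF C, of n 1 x] that car by simp
    also have "\<rho>6 1 x = 6 * x mod 25"
      using that car by (simp add: \<rho>6_1 \<alpha>6_def)
    finally show ?thesis .
  qed
  show ?thesis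
    using assms
  proof (induction n arbitrary: x rule: int_induct[where k = 0])
    case base
    then show ?case
      using action_one[OF C, of x] car by simp
  next
    case (step1 n)
    have "\<rho>6 (n + 1) x = ((1 + 5 * n) * (6 * x mod 25)) mod 25"
      using step[OF step1.prems] step1.IH[of "6 * x mod 25"] by simp
    also have "\<dots> = ((1 + 5 * n) * (6 * x)) mod 25"
      by (simp only: mod_mult_right_eq)
    also have "\<dots> = ((1 + 5 * (n + 1)) * x + 25 * (n * x)) mod 25"
      by (simp add: algebra_simps)
    finally show ?case by (simp only: mod_mult_self2)
  next
    case (step2 n)
    \<comment> \<open>21 is the inverse of 6 modulo 25, so \<open>step\<close> can be run
      backwards.\<close>
    have "6 * (21 * x mod 25) mod 25 = (6 * (21 * x)) mod 25"
      by (simp only: mod_mult_right_eq)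
    also have "\<dots> = (x + 25 * (5 * x)) mod 25"
      by simp
    also have "\<dots> = x"
      using step2.prems by (simp only: mod_mult_self2) simp
    finally have "\<rho>6 (n - 1) x = \<rho>6 n (21 * x mod 25)"
      using step[of "21 * x mod 25" "n - 1"] by simp
    also have "\<dots> = ((1 + 5 * n) * (21 * x mod 25)) mod 25"
      using step2.IH[of "21 * x mod 25"] by simp
    also have "\<dots> = ((1 + 5 * n) * (21 * x)) mod 25"
      by (simp only: mod_mult_right_eq)
    also have "\<dots> = ((1 + 5 * (n - 1)) * x + 25 * (x + 4 * (n * x))) mod 25"
      by (simp add: algebra_simps)
    finally show ?case by (simp only: mod_mult_self2)
  qed
qed

text \<open>This holds since \<open>1 + 5 * 5\<close> is 1 modulo 25. The identity of
  \<open>AutoGroup\<close> is a restricted function, so values outside the carrier are matched by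
  extensionality.\<close>

lemma \<rho>6_5: "\<rho>6 5 = \<one>\<^bsub>AutoGroup C25\<^esub>"
proof -
  have "\<rho>6 5 x = x" if x: "x \<in> {0..<25}" for x
  proof -
    have "\<rho>6 5 x = (x + 25 * x) mod 25"
      by (simp add: \<rho>6_eq[OF x])
    also have "\<dots> = x"
      using x by (simp only: mod_mult_self2) simp
    finally show ?thesis .
  qed
  moreover have "\<rho>6 5 \<in> extensional {0..<25}"
    using hom_in_carrier[OF \<rho>6_hom, of 5]
    by (simp add: AutoGroup_def auto_def Bij_def carrier_integer_mod_group)
  ultimately show ?thesis
    by (auto simp: AutoGroup_def BijGroup_def carrier_integer_mod_group extensional_def fun_eq_iff)
qed

text \<open>One family for both groups: \<open>u = 1\<close> gives \<open>G6\<close>, and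
  \<open>u = 2\<close> gives the competitor, where 1 acts as multiplication by 11.\<close>

definition C25_twist :: "int \<Rightarrow> (int \<times> int) monoid" where
  "C25_twist u = semidirect_product C25 (\<lambda>n. \<rho>6 (u * n)) integer_group"

lemma C25_twist_simps:
  "carrier (C25_twist u) = {0..<25} \<times> UNIV"
  "(a, x) \<otimes>\<^bsub>C25_twist u\<^esub> (b, y) = ((a + \<rho>6 (u * x) b) mod 25, x + y)"
  "\<one>\<^bsub>C25_twist u\<^esub> = (0, 0)"
  by (simp_all add: C25_twist_def semidirect_product_def carrier_integer_mod_group mult_integer_mod_group)

lemma snd_C25_twist_mult:
  "snd (p \<otimes>\<^bsub>C25_twist u\<^esub> q) = snd p + snd q"
  by (simp add: C25_twist_def semidirect_product_def case_prod_unfold)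

lemma group_C25_twist: "group (C25_twist u)"
  unfolding C25_twist_def by (intro group_semidirect_product twisted_action_hom \<rho>6_hom) simp_all

lemma finitely_generated_C25_twist: "finitely_generated_group (C25_twist u)"
proof -
  have "generate C25 (carrier C25) = carrier C25"
    by (intro equalityI group.generate_incl subsetI generate.incl) simp_all
  then have "finitely_generated_group C25"
    unfolding finitely_generated_group_def
    by (intro conjI exI[of _ "carrier C25"]) (simp_all add: carrier_integer_mod_group)
  moreover obtain x where "subgroup_generated integer_group {x} = integer_group"
    using cyclic_integer_group unfolding cyclic_group_def by blast
  then have "generate integer_group {x} = carrier integer_group"
    using carrier_subgroup_generated[of integer_group "{x}"] by simp
  then have "finitely_generated_group integer_group"
    unfolding finitely_generated_group_def by (intro conjI exI[of _ "{x}"]) auto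
  ultimately show ?thesis
    unfolding C25_twist_def by (intro finitely_generated_semidirect_product twisted_action_hom \<rho>6_hom) simp_all
qed

lemma C25_twist_pow:
  assumes "a \<in> {0..<25}"
  shows "(a, 0) [^]\<^bsub>C25_twist u\<^esub> (k::nat) = ((int k * a) mod 25, 0)"
proof (induction k)
  case 0
  then show ?case by (simp add: C25_twist_simps)
next
  case (Suc k)
  then show ?case
    using assms by (simp add: C25_twist_simps \<rho>6_eq mod_simps algebra_simps)
qed

text \<open>An isomorphism preserves the torsion subgroup \<open>C\<^sub>2\<^sub>5\<close>, hence maps the generator \<open>t\<close> of \<open>\<int>\<close>
  to \<open>s t\<close> or \<open>s t\<^sup>-\<^sup>1\<close> with \<open>s\<close> in \<open>C\<^sub>2\<^sub>5\<close>; but modulo 25, \<open>6\<^sup>2 = 11\<close> is neither 6 nor its inverse 21.\<close>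

lemma C25_twist_not_iso: "\<not> C25_twist 2 \<cong> C25_twist 1"
proof
  assume "C25_twist 2 \<cong> C25_twist 1"
  then obtain h where h: "h \<in> iso (C25_twist 2) (C25_twist 1)"
    by (auto simp: is_iso_def)
  then have inj: "inj_on h (carrier (C25_twist 2))"
    and surj: "h ` carrier (C25_twist 2) = carrier (C25_twist 1)"
    by (simp_all add: iso_iff)
  interpret group_hom "C25_twist 2" "C25_twist 1" h
    using h by (simp add: group_hom_def group_hom_axioms_def group_C25_twist iso_iff)
  have car: "(a, j) \<in> carrier (C25_twist u)" if "a \<in> {0..<25}" for a j u
    using that by (simp add: C25_twist_simps)
  have h_car: "h p \<in> {0..<25} \<times> UNIV" if "p \<in> carrier (C25_twist 2)" for p
    using hom_closed[OF that] by (simp only: C25_twist_simps)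
  have h_0: "h (0, 0) = (0, 0)"
    using hom_one by (simp add: C25_twist_simps)
  have snd_h: "snd (h (p \<otimes>\<^bsub>C25_twist 2\<^esub> q)) = snd (h p) + snd (h q)"
    if "p \<in> carrier (C25_twist 2)" "q \<in> carrier (C25_twist 2)" for p q
    using that by (simp add: snd_C25_twist_mult)
  have snd_pow: "snd (h (p [^]\<^bsub>C25_twist 2\<^esub> k)) = int k * snd (h p)"
    if "p \<in> carrier (C25_twist 2)" for p and k :: nat
  proof (induction k)
    case 0
    then show ?case by (simp add: C25_twist_simps h_0)
  next
    case (Suc k)
    then show ?case
      using that by (simp add: snd_h algebra_simps del: hom_mult)
  qed
  \<comment> \<open>The 25th power of \<open>(a, 0)\<close> is trivial, and \<int> has no
    torsion.\<close>
  have tors: "snd (h (a, 0)) = 0" if "a \<in> {0..<25}" for a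
    using snd_pow[of "(a, 0)" 25] that
    by (simp add: C25_twist_pow C25_twist_simps h_0)
  obtain x where x: "h (1, 0) = (x, 0)" "x \<in> {0..<25}"
    using tors[of 1] h_car[OF car, of 1 0] by (cases "h (1, 0)") auto
  have pow_h: "h (int k mod 25, 0) = ((int k * x) mod 25, 0)" for k :: nat
    using hom_nat_pow[of "(1, 0)" k] C25_twist_pow[of 1 2 k] C25_twist_pow[OF x(2), of 1 k]
    by (simp add: car x(1))
  have "\<not> 5 dvd x"
  proof
    assume "5 dvd x"
    then have "(5 * x) mod 25 = 0"
      by (auto elim!: dvdE)
    then have "h (5, 0) = h (0, 0)"
      using pow_h[of 5] pow_h[of 0] by simp
    then show False
      using inj car[of 5 0 2] car[of 0 0 2] by (auto dest: inj_onD)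
  qed
  obtain s n where sn: "h (0, 1) = (s, n)" "s \<in> {0..<25}"
    using h_car[OF car, of 0 1] by (cases "h (0, 1)") auto
  \<comment> \<open>The defining relation of the competitor. Its image under \<open>h\<close>
    compares the factors \<open>1 + 5 * n\<close> and 11 on \<open>x\<close>; as 5 does not divide
    \<open>x\<close>, this gives \<open>n\<close> congruent to 2 modulo 5.\<close>
  have "(0, 1) \<otimes>\<^bsub>C25_twist 2\<^esub> (1, 0) = (11, 0) \<otimes>\<^bsub>C25_twist 2\<^esub> (0, 1)"
    by (simp add: C25_twist_simps \<rho>6_eq)
  then have "h (0, 1) \<otimes>\<^bsub>C25_twist 1\<^esub> h (1, 0) = h (11, 0) \<otimes>\<^bsub>C25_twist 1\<^esub> h (0, 1)"
    using car[of 0 1 2] car[of 1 0 2] car[of 11 0 2] by (simp flip: hom_mult)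
  then have "(s + \<rho>6 n x) mod 25 = (11 * x + s) mod 25"
    using pow_h[of 11] sn x by (simp add: C25_twist_simps \<rho>6_eq mod_simps)
  then have "(s + (1 + 5 * n) * x) mod 25 = (11 * x + s) mod 25"
    using x(2) by (simp add: \<rho>6_eq mod_simps)
  then have "25 dvd (s + (1 + 5 * n) * x) - (11 * x + s)"
    by (simp add: mod_eq_dvd_iff)
  also have "(s + (1 + 5 * n) * x) - (11 * x + s) = 5 * ((n - 2) * x)"
    by (simp add: algebra_simps)
  finally have "5 dvd (n - 2) * x"
    by presburger
  then have n: "5 dvd n - 2"
    using \<open>\<not> 5 dvd x\<close> prime_dvd_mult_iff[of "5::int" "n - 2" x] by simp
  have add: "snd (h (0, i + j)) = snd (h (0, i)) + snd (h (0, j))" for i j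
    using snd_h[of "(0, i)" "(0, j)"] car by (simp add: C25_twist_simps \<rho>6_eq)
  have lin: "snd (h (0, j)) = j * n" for j
  proof (induction j rule: int_induct[where k = 0])
    case base
    then show ?case by (simp add: tors)
  next
    case (step1 i)
    then show ?case using add[of i 1] sn by (simp add: algebra_simps)
  next
    case (step2 i)
    then show ?case using add[of "i - 1" 1] sn by (simp add: algebra_simps)
  qed
  \<comment> \<open>All \<int>-coordinates of images are multiples of \<open>n\<close>, so
    surjectivity forces \<open>n\<close> to be 1 or -1; neither is 2 modulo 5.\<close>
  have "(0, 1) \<in> h ` carrier (C25_twist 2)"
    unfolding surj by (rule car) simp
  then obtain a j where aj: "h (a, j) = (0, 1)" "a \<in> {0..<25}"
    by (auto simp: C25_twist_simps)
  have "snd (h (a, j)) = j * n"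
    using snd_h[of "(a, 0)" "(0, j)"] car aj(2) tors[OF aj(2)] lin[of j]
    by (simp add: C25_twist_simps \<rho>6_eq)
  then have "n dvd 1"
    using aj(1) dvd_triv_right[of n j] by simp
  then have "n = 1 \<or> n = -1"
    by auto
  with n show False by auto
qed

theorem proposition6p3:
  shows "\<not> first_order_rigid G6"
proof
  assume rigid: "first_order_rigid G6"
  have G6: "G6 = C25_twist 1"
    by (simp add: G6_def C25_twist_def)
  \<comment> \<open>The general twist result applies with period \<open>d = 5\<close> and the unit
    \<open>u = 2\<close> modulo 5.\<close>
  have "elementarily_equivalent G6 (C25_twist 2)"
    unfolding G6_def C25_twist_def
    by (rule elementarily_equivalent_twist[OF _ \<rho>6_hom \<rho>6_5]) simp_all
  then have "elementarily_equivalent (C25_twist 2) G6"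
    by (simp add: elementarily_equivalent_def)
  moreover have "finitely_generated_group (C25_twist 2)"
    by (rule finitely_generated_C25_twist)
  ultimately have "C25_twist 2 \<cong> G6"
    by (intro first_order_rigid_any_type[OF rigid])
  then show False
    using C25_twist_not_iso by (simp add: G6)
qed

end
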